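(* There is a deterministic algorithm that, given a graph $G=(V,E,w)$ with $n$ vertices, $m$ edges and nonnegative weights $w_{ij}$, runs in time $O(n^2(n+m))$ and outputs a hierarchical clustering $T$ on $V$ with $\sum_{(i,j)\in E}w_{ij}|T_{ij}|\ge\frac23\max_{T'}\sum_{(i,j)\in E}w_{ij}|T'_{ij}|$, the maximum over all hierarchical clusterings $T'$ on $V$.
   Context: A hierarchical clustering on $V$ is a rooted binary tree with leaf set $V$; $T_{ij}$ is the subtree rooted at the lowest common ancestor of $i,j$ and $|T_{ij}|$ is its number of leaves. *)

theory Defs
  imports Complex_Main
begin

section \<open>Hierarchical clusterings\<close>

text \<open>Children are ordered here; the order affects neither the leaf set nor the objective.\<close>

datatype 'a htree = Leaf 'a | Node "'a htree" "'a htree"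

fun leaves :: "'a htree \<Rightarrow> 'a list" where
  "leaves (Leaf a) = [a]"
| "leaves (Node l r) = leaves l @ leaves r"

definition hierarchical_clustering :: "'a set \<Rightarrow> 'a htree \<Rightarrow> bool" where
  "hierarchical_clustering V T \<longleftrightarrow> distinct (leaves T) \<and> set (leaves T) = V"

fun subtrees :: "'a htree \<Rightarrow> 'a htree set" where
  "subtrees (Leaf a) = {Leaf a}"
| "subtrees (Node l r) = insert (Node l r) (subtrees l \<union> subtrees r)"

text \<open>The subtree rooted at the lowest common ancestor of the leaves in \<open>e\<close>; it is meaningful
  for nonempty \<open>e \<subseteq> set (leaves T)\<close>, see \<open>lca_subtree_lowest\<close>.\<close>

fun lca_subtree :: "'a htree \<Rightarrow> 'a set \<Rightarrow> 'a htree" where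
  "lca_subtree (Leaf a) e = Leaf a"
| "lca_subtree (Node l r) e =
     (if e \<subseteq> set (leaves l) then lca_subtree l e
      else if e \<subseteq> set (leaves r) then lca_subtree r e
      else Node l r)"

lemma subtrees_refl: "T \<in> subtrees T"
  by (cases T) auto

lemma leaves_subtree: "S \<in> subtrees T \<Longrightarrow> set (leaves S) \<subseteq> set (leaves T)"
  by (induction T) auto

lemma lca_subtree_common:
  "e \<subseteq> set (leaves T) \<Longrightarrow>
   lca_subtree T e \<in> subtrees T \<and> e \<subseteq> set (leaves (lca_subtree T e))"
  by (induction T) auto

lemma lca_subtree_lowest:
  assumes "distinct (leaves T)" "e \<noteq> {}" "S \<in> subtrees T" "e \<subseteq> set (leaves S)"
  shows "lca_subtree T e \<in> subtrees S"
  using assms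
proof (induction T)
  case (Leaf a)
  then show ?case by simp
next
  case (Node l r)
  have disj: "set (leaves l) \<inter> set (leaves r) = {}"
    using Node.prems(1) by simp
  consider "S = Node l r" | "S \<in> subtrees l" | "S \<in> subtrees r"
    using Node.prems(3) by auto
  then show ?case
  proof cases
    case 1
    then show ?thesis
      using Node.prems(4) lca_subtree_common[of e "Node l r"] by simp
  next
    case 2
    then have "e \<subseteq> set (leaves l)"
      using Node.prems(4) leaves_subtree by blast
    then show ?thesis using 2 Node by simp
  next
    case 3
    then have "e \<subseteq> set (leaves r)"
      using Node.prems(4) leaves_subtree by blast
    moreover from this have "\<not> e \<subseteq> set (leaves l)"
      using disj Node.prems(2) by blast
    ultimately show ?thesis using 3 Node by simp
  qed
qed

section \<open>Weighted graphs and the objective\<close>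

text \<open>Simple undirected graphs; an edge is the set of its two endpoints.\<close>

definition weighted_graph :: "'a set \<Rightarrow> 'a set set \<Rightarrow> ('a set \<Rightarrow> real) \<Rightarrow> bool" where
  "weighted_graph V E w \<longleftrightarrow>
     finite V \<and> V \<noteq> {} \<and> (\<forall>e\<in>E. e \<subseteq> V \<and> card e = 2) \<and> (\<forall>e\<in>E. 0 \<le> w e)"

definition hc_value :: "'a set set \<Rightarrow> ('a set \<Rightarrow> real) \<Rightarrow> 'a htree \<Rightarrow> real" where
  "hc_value E w T = (\<Sum>e\<in>E. w e * real (length (leaves (lca_subtree T e))))"

text \<open>The maximum of the objective is taken over a finite nonempty set.\<close>

lemma finite_htree_leaves: "finite {T. leaves T = xs}"
proof (induction xs rule: length_induct)
  case (1 xs)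
  have ne: "leaves T \<noteq> []" for T :: "'a htree"
    by (induction T) auto
  let ?A = "\<lambda>k. {T. leaves T = take k xs}" and ?B = "\<lambda>k. {T. leaves T = drop k xs}"
  let ?K = "{k. 0 < k \<and> k < length xs}"
  have "{T. leaves T = xs} \<subseteq>
      Leaf ` set xs \<union> (\<Union>k\<in>?K. (\<lambda>(l, r). Node l r) ` (?A k \<times> ?B k))"
  proof
    fix T assume "T \<in> {T. leaves T = xs}"
    then have T: "leaves T = xs" by simp
    show "T \<in> Leaf ` set xs \<union> (\<Union>k\<in>?K. (\<lambda>(l, r). Node l r) ` (?A k \<times> ?B k))"
    proof (cases T)
      case (Leaf a)
      then show ?thesis using T by auto
    next
      case (Node l r)
      let ?k = "length (leaves l)"
      have "?k \<in> ?K" using T Node ne[of l] ne[of r] by auto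
      moreover have "(l, r) \<in> ?A ?k \<times> ?B ?k" using T Node by auto
      ultimately show ?thesis using Node by force
    qed
  qed
  moreover have "finite (Leaf ` set xs \<union> (\<Union>k\<in>?K. (\<lambda>(l, r). Node l r) ` (?A k \<times> ?B k)))"
    using 1 by auto
  ultimately show ?case by (rule finite_subset)
qed

lemma finite_hierarchical_clusterings:
  assumes "finite V"
  shows "finite {T. hierarchical_clustering V T}"
proof -
  have "{T. hierarchical_clustering V T} \<subseteq>
      (\<Union>xs\<in>{xs. set xs = V \<and> distinct xs}. {T. leaves T = xs})"
    by (auto simp: hierarchical_clustering_def)
  moreover have "finite {xs. set xs = V \<and> distinct xs}"
    by (rule finite_subset[OF _ finite_lists_length_eq[OF assms, of "card V"]])
       (auto simp: distinct_card)
  ultimately show ?thesis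
    by (rule finite_subset[OF _ finite_UN_I]) (rule finite_htree_leaves)
qed

lemma hierarchical_clustering_exists:
  assumes "finite V" "V \<noteq> {}"
  shows "\<exists>T. hierarchical_clustering V T"
  using assms
proof (induction V rule: finite_ne_induct)
  case (singleton x)
  have "hierarchical_clustering {x} (Leaf x)" by (simp add: hierarchical_clustering_def)
  then show ?case ..
next
  case (insert x F)
  then obtain T where "hierarchical_clustering F T" by blast
  then have "hierarchical_clustering (insert x F) (Node (Leaf x) T)"
    using insert by (simp add: hierarchical_clustering_def)
  then show ?case ..
qed

section \<open>A deterministic real random access machine\<close>

text \<open>
  Programs compute with natural numbers, which also serve as addresses, and with exact reals.
  Memory consists of named scalars and named unbounded arrays; since a program mentions only
  finitely many names, this is a single random access memory up to a constant factor.
  Every operation, memory access, test and assignment costs one unit of time.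
  On naturals there are only addition and truncated subtraction: multiplication at unit cost
  would make unbounded registers too powerful. Reals carry the field operations and comparison;
  there is no rounding from reals to naturals. As everywhere in HOL, \<open>x / 0 = 0\<close>.
\<close>

datatype nexp =
    NConst nat
  | NVar string
  | NArr string nexp
  | NPlus nexp nexp
  | NMinus nexp nexp

datatype rexp =
    RConst rat
  | RVar string
  | RArr string nexp
  | ROfNat nexp
  | RPlus rexp rexp
  | RMinus rexp rexp
  | RTimes rexp rexp
  | RDiv rexp rexp

datatype bexp =
    NLess nexp nexp
  | RLess rexp rexp
  | BNot bexp
  | BAnd bexp bexp

datatype com =
    Skip
  | NAssign string nexp
  | NStore string nexp nexp
  | RAssign string rexp
  | RStore string nexp rexp
  | Seq com com
  | Cond bexp com com
  | While bexp com

record state =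
  nvar :: "string \<Rightarrow> nat"
  narr :: "string \<Rightarrow> nat \<Rightarrow> nat"
  rvar :: "string \<Rightarrow> real"
  rarr :: "string \<Rightarrow> nat \<Rightarrow> real"

fun nval :: "nexp \<Rightarrow> state \<Rightarrow> nat" where
  "nval (NConst k) s = k"
| "nval (NVar x) s = nvar s x"
| "nval (NArr a i) s = narr s a (nval i s)"
| "nval (NPlus e f) s = nval e s + nval f s"
| "nval (NMinus e f) s = nval e s - nval f s"

fun rval :: "rexp \<Rightarrow> state \<Rightarrow> real" where
  "rval (RConst q) s = of_rat q"
| "rval (RVar x) s = rvar s x"
| "rval (RArr a i) s = rarr s a (nval i s)"
| "rval (ROfNat e) s = real (nval e s)"
| "rval (RPlus e f) s = rval e s + rval f s"
| "rval (RMinus e f) s = rval e s - rval f s"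
| "rval (RTimes e f) s = rval e s * rval f s"
| "rval (RDiv e f) s = rval e s / rval f s"

fun bval :: "bexp \<Rightarrow> state \<Rightarrow> bool" where
  "bval (NLess e f) s = (nval e s < nval f s)"
| "bval (RLess e f) s = (rval e s < rval f s)"
| "bval (BNot b) s = (\<not> bval b s)"
| "bval (BAnd b c) s = (bval b s \<and> bval c s)"

fun ncost :: "nexp \<Rightarrow> nat" where
  "ncost (NConst k) = 1"
| "ncost (NVar x) = 1"
| "ncost (NArr a i) = 1 + ncost i"
| "ncost (NPlus e f) = 1 + ncost e + ncost f"
| "ncost (NMinus e f) = 1 + ncost e + ncost f"

fun rcost :: "rexp \<Rightarrow> nat" where
  "rcost (RConst q) = 1"
| "rcost (RVar x) = 1"
| "rcost (RArr a i) = 1 + ncost i"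
| "rcost (ROfNat e) = 1 + ncost e"
| "rcost (RPlus e f) = 1 + rcost e + rcost f"
| "rcost (RMinus e f) = 1 + rcost e + rcost f"
| "rcost (RTimes e f) = 1 + rcost e + rcost f"
| "rcost (RDiv e f) = 1 + rcost e + rcost f"

fun bcost :: "bexp \<Rightarrow> nat" where
  "bcost (NLess e f) = 1 + ncost e + ncost f"
| "bcost (RLess e f) = 1 + rcost e + rcost f"
| "bcost (BNot b) = 1 + bcost b"
| "bcost (BAnd b c) = 1 + bcost b + bcost c"

text \<open>\<open>exec c s t s'\<close>: started in \<open>s\<close>, the program \<open>c\<close> halts in \<open>s'\<close> after \<open>t\<close> units of time.\<close>

inductive exec :: "com \<Rightarrow> state \<Rightarrow> nat \<Rightarrow> state \<Rightarrow> bool" where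
  Skip: "exec Skip s 1 s"
| NAssign: "exec (NAssign x e) s (1 + ncost e)
    (s\<lparr>nvar := (nvar s)(x := nval e s)\<rparr>)"
| NStore: "exec (NStore a i e) s (1 + ncost i + ncost e)
    (s\<lparr>narr := (narr s)(a := (narr s a)(nval i s := nval e s))\<rparr>)"
| RAssign: "exec (RAssign x e) s (1 + rcost e)
    (s\<lparr>rvar := (rvar s)(x := rval e s)\<rparr>)"
| RStore: "exec (RStore a i e) s (1 + ncost i + rcost e)
    (s\<lparr>rarr := (rarr s)(a := (rarr s a)(nval i s := rval e s))\<rparr>)"
| Seq: "exec c s t s' \<Longrightarrow> exec d s' u s'' \<Longrightarrow> exec (Seq c d) s (t + u) s''"
| CondTrue: "bval b s \<Longrightarrow> exec c s t s' \<Longrightarrow> exec (Cond b c d) s (1 + bcost b + t) s'"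
| CondFalse: "\<not> bval b s \<Longrightarrow> exec d s t s' \<Longrightarrow> exec (Cond b c d) s (1 + bcost b + t) s'"
| WhileFalse: "\<not> bval b s \<Longrightarrow> exec (While b c) s (1 + bcost b) s"
| WhileTrue: "bval b s \<Longrightarrow> exec c s t s' \<Longrightarrow> exec (While b c) s' u s'' \<Longrightarrow>
    exec (While b c) s (1 + bcost b + t + u) s''"

inductive_cases SkipE: "exec Skip s t s'"
inductive_cases NAssignE: "exec (NAssign x e) s t s'"
inductive_cases NStoreE: "exec (NStore a i e) s t s'"
inductive_cases RAssignE: "exec (RAssign x e) s t s'"
inductive_cases RStoreE: "exec (RStore a i e) s t s'"
inductive_cases SeqE: "exec (Seq c d) s t s'"
inductive_cases CondE: "exec (Cond b c d) s t s'"
inductive_cases WhileE: "exec (While b c) s t s'"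

lemma exec_deterministic:
  "exec c s t s' \<Longrightarrow> exec c s u s'' \<Longrightarrow> u = t \<and> s'' = s'"
proof (induction arbitrary: u s'' rule: exec.induct)
  case Skip
  then show ?case by (auto elim: SkipE)
next
  case NAssign
  then show ?case by (auto elim: NAssignE)
next
  case NStore
  then show ?case by (auto elim: NStoreE)
next
  case RAssign
  then show ?case by (auto elim: RAssignE)
next
  case RStore
  then show ?case by (auto elim: RStoreE)
next
  case (Seq c s t s' d v s2)
  from Seq.prems obtain t1 r u1 where
    "exec c s t1 r" "exec d r u1 s''" "u = t1 + u1" by (rule SeqE)
  then show ?case using Seq.IH(1)[of t1 r] Seq.IH(2)[of u1 s''] by simp
next
  case (CondTrue b s c t s' d)
  from CondTrue.prems obtain t1 where
    "exec c s t1 s''" "u = 1 + bcost b + t1" by (rule CondE) (use CondTrue.hyps in auto)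
  then show ?case using CondTrue.IH[of t1 s''] by simp
next
  case (CondFalse b s d t s' c)
  from CondFalse.prems obtain t1 where
    "exec d s t1 s''" "u = 1 + bcost b + t1" by (rule CondE) (use CondFalse.hyps in auto)
  then show ?case using CondFalse.IH[of t1 s''] by simp
next
  case (WhileFalse b s c)
  from WhileFalse.prems show ?case by (rule WhileE) (use WhileFalse.hyps in auto)
next
  case (WhileTrue b s c t s' v s2)
  from WhileTrue.prems obtain t1 r u1 where
    "exec c s t1 r" "exec (While b c) r u1 s''" "u = 1 + bcost b + t1 + u1"
    by (rule WhileE) (use WhileTrue.hyps in auto)
  then show ?case using WhileTrue.IH(1)[of t1 r] WhileTrue.IH(2)[of u1 s''] by simp
qed

section \<open>Input and output conventions\<close>

text \<open>A graph with vertex set \<open>{..<n}\<close> is given as a list of its edges, in any order, each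
  written once with its endpoints in either order.\<close>

definition edge_listing :: "'a set set \<Rightarrow> ('a \<times> 'a) list \<Rightarrow> bool" where
  "edge_listing E es \<longleftrightarrow>
     distinct (map (\<lambda>(i, j). {i, j}) es) \<and> set (map (\<lambda>(i, j). {i, j}) es) = E"

text \<open>All memory not holding the input is zero.\<close>

definition input_state :: "nat \<Rightarrow> (nat \<times> nat) list \<Rightarrow> (nat set \<Rightarrow> real) \<Rightarrow> state" where
  "input_state n es w =
     \<lparr>nvar = (\<lambda>_. 0)(''n'' := n, ''m'' := length es),
      narr = (\<lambda>_ _. 0)
        (''src'' := \<lambda>k. if k < length es then fst (es ! k) else 0,
         ''dst'' := \<lambda>k. if k < length es then snd (es ! k) else 0),
      rvar = (\<lambda>_. 0),
      rarr = (\<lambda>_ _. 0)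
        (''w'' := \<lambda>k. if k < length es then w {fst (es ! k), snd (es ! k)} else 0)\<rparr>"

text \<open>Tree nodes are addresses: \<open>v < n\<close> is the leaf labelled \<open>v\<close>, any other \<open>v\<close> is an inner node
  whose children are stored at position \<open>v\<close> of the arrays \<open>left\<close> and \<open>right\<close>.\<close>

inductive tree_at :: "nat \<Rightarrow> state \<Rightarrow> nat \<Rightarrow> nat htree \<Rightarrow> bool" for n s where
  tree_at_Leaf: "v < n \<Longrightarrow> tree_at n s v (Leaf v)"
| tree_at_Node: "\<not> v < n \<Longrightarrow> tree_at n s (narr s ''left'' v) l \<Longrightarrow>
    tree_at n s (narr s ''right'' v) r \<Longrightarrow> tree_at n s v (Node l r)"

definition output_tree :: "nat \<Rightarrow> state \<Rightarrow> nat htree \<Rightarrow> bool" where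
  "output_tree n s T \<longleftrightarrow> tree_at n s (nvar s ''root'') T"

lemma tree_at_unique: "tree_at n s v T \<Longrightarrow> tree_at n s v T' \<Longrightarrow> T' = T"
proof (induction arbitrary: T' rule: tree_at.induct)
  case (tree_at_Leaf v)
  from tree_at_Leaf(2,1) show ?case by cases auto
next
  case (tree_at_Node v l r)
  from tree_at_Node.prems obtain l' r' where
    "T' = Node l' r'" "tree_at n s (narr s ''left'' v) l'" "tree_at n s (narr s ''right'' v) r'"
    by (rule tree_at.cases) (use tree_at_Node.hyps in simp_all)
  then show ?case using tree_at_Node.IH(1)[of l'] tree_at_Node.IH(2)[of r'] by simp
qed

end

theory Submission
  imports Defs
begin

text \<open>Every clustering has value at most \<open>n W\<close>, where \<open>W\<close> is the total weight. A caterpillar tree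
  splits off one vertex at a time; if the order is uniformly random, a third vertex is removed
  before both ends of a given edge with probability \<open>1/3\<close>, so the expected value is at least
  \<open>2/3 n W\<close>. Always removing a vertex of maximum weighted degree in the remaining graph
  derandomizes this, and recomputing all degrees from the edge list for each removal takes time
  \<open>O(n (n + m))\<close> altogether.\<close>

section \<open>Peeling vertices of maximum degree\<close>

definition induced_weight :: "'a set set \<Rightarrow> ('a set \<Rightarrow> real) \<Rightarrow> 'a set \<Rightarrow> real" where
  "induced_weight E w S = sum w {e \<in> E. e \<subseteq> S}"

definition wdegree :: "'a set set \<Rightarrow> ('a set \<Rightarrow> real) \<Rightarrow> 'a set \<Rightarrow> 'a \<Rightarrow> real" where
  "wdegree E w S u = sum w {e \<in> E. e \<subseteq> S \<and> u \<in> e}"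

lemma finite_edges:
  assumes "weighted_graph V E w"
  shows "finite E"
proof (rule finite_subset)
  show "E \<subseteq> Pow V" "finite (Pow V)" using assms by (auto simp: weighted_graph_def)
qed

lemma wdegree_nonneg: "weighted_graph V E w \<Longrightarrow> 0 \<le> wdegree E w S u"
  unfolding weighted_graph_def wdegree_def by (auto intro: sum_nonneg)

text \<open>Handshake identity: exchanging the two sums counts each edge once for each of its two
  endpoints.\<close>

lemma sum_wdegree:
  assumes "weighted_graph V E w" "finite S"
  shows "(\<Sum>u\<in>S. wdegree E w S u) = 2 * induced_weight E w S"
proof -
  have fin: "finite {e \<in> E. e \<subseteq> S}" using finite_edges[OF assms(1)] by simp
  have "(\<Sum>u\<in>S. wdegree E w S u) = (\<Sum>u\<in>S. \<Sum>e\<in>{e \<in> E. e \<subseteq> S}. if u \<in> e then w e else 0)"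
  proof (intro sum.cong refl)
    fix u
    have "{e \<in> E. e \<subseteq> S \<and> u \<in> e} = {e \<in> {e \<in> E. e \<subseteq> S}. u \<in> e}" by auto
    then show "wdegree E w S u = (\<Sum>e\<in>{e \<in> E. e \<subseteq> S}. if u \<in> e then w e else 0)"
      unfolding wdegree_def by (simp only: sum.inter_filter[OF fin])
  qed
  also have "\<dots> = (\<Sum>e\<in>{e \<in> E. e \<subseteq> S}. \<Sum>u\<in>S. if u \<in> e then w e else 0)"
    by (rule sum.swap)
  also have "\<dots> = (\<Sum>e\<in>{e \<in> E. e \<subseteq> S}. 2 * w e)"
  proof (intro sum.cong refl)
    fix e assume e: "e \<in> {e \<in> E. e \<subseteq> S}"
    then have "{u \<in> S. u \<in> e} = e" "card e = 2"
      using assms(1) by (auto simp: weighted_graph_def)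
    then show "(\<Sum>u\<in>S. if u \<in> e then w e else 0) = 2 * w e"
      using assms(2) by (simp add: sum.inter_filter[symmetric])
  qed
  finally show ?thesis by (simp add: induced_weight_def sum_distrib_left)
qed

section \<open>Caterpillar trees and the value of a peeling order\<close>

fun caterpillar :: "'a list \<Rightarrow> 'a htree" where
  "caterpillar [] = undefined"
| "caterpillar [v] = Leaf v"
| "caterpillar (v # u # vs) = Node (Leaf v) (caterpillar (u # vs))"

lemma caterpillar_Cons:
  "vs \<noteq> [] \<Longrightarrow> caterpillar (v # vs) = Node (Leaf v) (caterpillar vs)"
  by (cases vs) auto

lemma leaves_caterpillar: "vs \<noteq> [] \<Longrightarrow> leaves (caterpillar vs) = vs"
  by (induction vs rule: caterpillar.induct) auto

text \<open>\<open>drop p vs\<close> holds the vertices still present just before removal number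
  \<open>p\<close>, so this is the greedy rule; ties may be broken in any way.\<close>

definition peeling :: "'a set set \<Rightarrow> ('a set \<Rightarrow> real) \<Rightarrow> 'a list \<Rightarrow> bool" where
  "peeling E w vs \<longleftrightarrow> (\<forall>p<length vs. \<forall>u\<in>set (drop p vs).
     wdegree E w (set (drop p vs)) u \<le> wdegree E w (set (drop p vs)) (vs ! p))"

lemma peeling_Cons:
  "peeling E w (v # vs) \<longleftrightarrow>
     (\<forall>u\<in>set (v # vs). wdegree E w (set (v # vs)) u \<le> wdegree E w (set (v # vs)) v) \<and>
     peeling E w vs"
  unfolding peeling_def length_Cons All_less_Suc2 by simp

text \<open>With \<open>k\<close> vertices of total weight \<open>W\<close> left, the removed vertex has degree \<open>d \<ge> 2 W / k\<close>, and
  its \<open>d\<close> units of weight get a subtree of size \<open>k\<close>: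
  \<open>k d + 2/3 (k - 1) (W - d) \<ge> 2/3 k W\<close>.\<close>

lemma peeling_value:
  assumes "weighted_graph V E w" "vs \<noteq> []" "distinct vs" "peeling E w vs"
  shows "2 / 3 * real (length vs) * induced_weight E w (set vs) \<le>
    hc_value {e \<in> E. e \<subseteq> set vs} w (caterpillar vs)"
  using assms(2-)
proof (induction vs rule: list_nonempty_induct)
  case (single v)
  have "\<not> e \<subseteq> {v}" if "e \<in> E" for e
    using assms(1) that card_mono[of "{v}" e] by (auto simp: weighted_graph_def)
  then have none: "{e \<in> E. e \<subseteq> {v}} = {}" by blast
  show ?case unfolding induced_weight_def hc_value_def by (simp add: none)
next
  case (cons v vs)
  let ?S = "set (v # vs)" and ?k = "real (length (v # vs))"
  let ?d = "wdegree E w ?S v" and ?W = "induced_weight E w ?S"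
  let ?A = "{e \<in> E. e \<subseteq> ?S \<and> v \<in> e}" and ?B = "{e \<in> E. e \<subseteq> set vs}"
  have fin: "finite E" using finite_edges[OF assms(1)] .
  have v: "v \<notin> set vs" using cons.prems by simp
  have split: "{e \<in> E. e \<subseteq> ?S} = ?A \<union> ?B" "?A \<inter> ?B = {}"
    using v by auto
  have W: "?W = ?d + induced_weight E w (set vs)"
    unfolding induced_weight_def wdegree_def split(1)
    using fin split(2) by (intro sum.union_disjoint) auto
  \<comment> \<open>The maximum degree is at least the average degree.\<close>
  have "2 * ?W = (\<Sum>u\<in>?S. wdegree E w ?S u)"
    by (rule sum_wdegree[OF assms(1), symmetric]) simp
  also have "\<dots> \<le> real (card ?S) * ?d"
    using cons.prems(2) unfolding peeling_Cons by (intro sum_bounded_above) auto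
  also have "real (card ?S) = ?k" using distinct_card[OF cons.prems(1)] by simp
  finally have d: "2 * ?W \<le> ?k * ?d" .
  \<comment> \<open>An edge at \<open>v\<close> is separated at the root. It cannot fit into the
    left child \<open>Leaf v\<close>, as it has two elements. Every other edge descends into the
    tail.\<close>
  have size: "length (leaves (lca_subtree (caterpillar (v # vs)) e)) =
      (if v \<in> e then length (v # vs) else length (leaves (lca_subtree (caterpillar vs) e)))"
    if "e \<in> E" "e \<subseteq> ?S" for e
  proof -
    have e2: "card e = 2" using assms(1) that(1) by (auto simp: weighted_graph_def)
    have "\<not> e \<subseteq> {v}" using card_mono[of "{v}" e] e2 by auto
    then show ?thesis
      using that(2) v cons.hyps by (auto simp: caterpillar_Cons leaves_caterpillar)
  qed
  have "hc_value {e \<in> E. e \<subseteq> ?S} w (caterpillar (v # vs)) =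
      hc_value ?A w (caterpillar (v # vs)) + hc_value ?B w (caterpillar (v # vs))"
    unfolding hc_value_def split(1) using fin split(2) by (intro sum.union_disjoint) auto
  also have "hc_value ?A w (caterpillar (v # vs)) = ?k * ?d"
    unfolding hc_value_def wdegree_def sum_distrib_left
    by (intro sum.cong refl) (simp add: size del: length_Cons)
  also have "hc_value ?B w (caterpillar (v # vs)) = hc_value ?B w (caterpillar vs)"
    unfolding hc_value_def using v by (intro sum.cong refl) (subst size, auto)
  finally have "hc_value {e \<in> E. e \<subseteq> ?S} w (caterpillar (v # vs)) =
      ?k * ?d + hc_value ?B w (caterpillar vs)" .
  moreover have "2 / 3 * real (length vs) * (?W - ?d) \<le> hc_value ?B w (caterpillar vs)"
    using cons.IH cons.prems unfolding W by (simp add: peeling_Cons)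
  \<comment> \<open>Writing k, d, W for \<open>?k\<close>, \<open>?d\<close>, \<open>?W\<close>, the
    right side minus the left is (k d - 2 W) / 3 + 2 d / 3, and both terms are nonnegative.\<close>
  moreover have "2 / 3 * ?k * ?W \<le> ?k * ?d + 2 / 3 * real (length vs) * (?W - ?d)"
    using d wdegree_nonneg[OF assms(1), of ?S v] by (simp add: field_simps)
  ultimately show ?case by linarith
qed

section \<open>Comparison with the optimum\<close>

lemma length_leaves_lca: "length (leaves (lca_subtree T e)) \<le> length (leaves T)"
  by (induction T) auto

lemma hc_value_le:
  assumes "weighted_graph V E w" "hierarchical_clustering V T"
  shows "hc_value E w T \<le> real (card V) * induced_weight E w V"
proof -
  have "length (leaves T) = card V"
    using assms(2) distinct_card unfolding hierarchical_clustering_def by metis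
  then have "hc_value E w T \<le> (\<Sum>e\<in>E. w e * real (card V))"
    unfolding hc_value_def using assms(1) length_leaves_lca[of T]
    by (intro sum_mono mult_left_mono) (auto simp: weighted_graph_def)
  moreover have "{e \<in> E. e \<subseteq> V} = E" using assms(1) by (auto simp: weighted_graph_def)
  ultimately show ?thesis
    unfolding induced_weight_def by (simp add: sum_distrib_right mult.commute)
qed

text \<open>The optimum and the caterpillar are both compared with n W, so the structure of an
  optimal tree never enters.\<close>

lemma peeling_two_thirds:
  assumes "weighted_graph V E w" "distinct vs" "set vs = V" "peeling E w vs"
  shows "hc_value E w (caterpillar vs) \<ge>
    2 / 3 * Max (hc_value E w ` {T. hierarchical_clustering V T})"
proof -
  have V: "finite V" "V \<noteq> {}" and E: "{e \<in> E. e \<subseteq> V} = E"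
    using assms(1) by (auto simp: weighted_graph_def)
  have "Max (hc_value E w ` {T. hierarchical_clustering V T}) \<le>
      real (card V) * induced_weight E w V"
    using hierarchical_clustering_exists[OF V] finite_hierarchical_clusterings[OF V(1)]
      hc_value_le[OF assms(1)] by (subst Max_le_iff) auto
  moreover have "2 / 3 * real (card V) * induced_weight E w V \<le> hc_value E w (caterpillar vs)"
    using peeling_value[OF assms(1) _ assms(2,4)] assms(3) V(2) E distinct_card[OF assms(2)]
    by fastforce
  ultimately show ?thesis by linarith
qed

section \<open>Total correctness with time bounds\<close>

text \<open>An upper bound in place of the exact time lets branches of different cost share one
  specification.\<close>

definition halts :: "com \<Rightarrow> state \<Rightarrow> nat \<Rightarrow> (state \<Rightarrow> bool) \<Rightarrow> bool" where
  "halts c s B Q \<longleftrightarrow> (\<exists>t s'. exec c s t s' \<and> t \<le> B \<and> Q s')"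

lemma halts_mono:
  "halts c s B Q \<Longrightarrow> B \<le> B' \<Longrightarrow> (\<And>s'. Q s' \<Longrightarrow> Q' s') \<Longrightarrow> halts c s B' Q'"
  unfolding halts_def by (meson order_trans)

lemma halts_Seq:
  assumes "halts c s B Q" "\<And>s'. Q s' \<Longrightarrow> halts d s' B' R"
  shows "halts (Seq c d) s (B + B') R"
proof -
  obtain t s' where c: "exec c s t s'" "t \<le> B" "Q s'" using assms(1) unfolding halts_def by blast
  obtain u s'' where "exec d s' u s''" "u \<le> B'" "R s''"
    using assms(2)[OF c(3)] unfolding halts_def by blast
  then show ?thesis unfolding halts_def using exec.Seq c(1,2) add_mono by meson
qed

text \<open>The invariant is indexed by the number of rounds done and has to force the exit exactly
  at \<open>N\<close>. The last summand of the bound pays for the final, failing test.\<close>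

lemma halts_While:
  assumes "I i s" "i \<le> N"
    and step: "\<And>i s. i < N \<Longrightarrow> I i s \<Longrightarrow> bval b s \<and> halts c s B (I (Suc i))"
    and exit: "\<And>s. I N s \<Longrightarrow> \<not> bval b s"
  shows "halts (While b c) s ((N - i) * (1 + bcost b + B) + (1 + bcost b)) (I N)"
  using assms(2,1)
proof (induction i arbitrary: s rule: inc_induct)
  case base
  then show ?case unfolding halts_def using exec.WhileFalse[OF exit] by fastforce
next
  case (step i)
  obtain t s' where t: "exec c s t s'" "t \<le> B" "I (Suc i) s'" and b: "bval b s"
    using assms(3)[OF step.hyps(2) step.prems] unfolding halts_def by blast
  obtain u s'' where u: "exec (While b c) s' u s''"
      "u \<le> (N - Suc i) * (1 + bcost b + B) + (1 + bcost b)" "I N s''"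
    using step.IH[OF t(3)] unfolding halts_def by blast
  have N: "N - i = Suc (N - Suc i)" using step.hyps(2) by simp
  have "1 + bcost b + t + u \<le> (N - i) * (1 + bcost b + B) + (1 + bcost b)"
    unfolding N mult_Suc using t(2) u(2) by linarith
  then show ?case unfolding halts_def using exec.WhileTrue[OF b t(1) u(1)] u(3) by blast
qed

section \<open>Loop-free code, evaluated by rewriting\<close>

fun straight_line :: "com \<Rightarrow> bool" where
  "straight_line (Seq c d) = (straight_line c \<and> straight_line d)"
| "straight_line (Cond b c d) = (straight_line c \<and> straight_line d)"
| "straight_line (While b c) = False"
| "straight_line _ = True"

text \<open>The last clause is correct for \<open>Skip\<close> and a dummy for \<open>While\<close>;
  results about \<open>run\<close> are therefore guarded by \<open>straight_line\<close>.\<close>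

fun run :: "com \<Rightarrow> state \<Rightarrow> state" where
  "run (NAssign x e) s = s\<lparr>nvar := (nvar s)(x := nval e s)\<rparr>"
| "run (NStore a i e) s = s\<lparr>narr := (narr s)(a := (narr s a)(nval i s := nval e s))\<rparr>"
| "run (RAssign x e) s = s\<lparr>rvar := (rvar s)(x := rval e s)\<rparr>"
| "run (RStore a i e) s = s\<lparr>rarr := (rarr s)(a := (rarr s a)(nval i s := rval e s))\<rparr>"
| "run (Seq c d) s = run d (run c s)"
| "run (Cond b c d) s = (if bval b s then run c s else run d s)"
| "run _ s = s"

text \<open>A conditional is charged for both branches: the sum bounds the maximum and simplifies to
  a plain numeral.\<close>

fun max_cost :: "com \<Rightarrow> nat" where
  "max_cost (NAssign x e) = 1 + ncost e"
| "max_cost (NStore a i e) = 1 + ncost i + ncost e"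
| "max_cost (RAssign x e) = 1 + rcost e"
| "max_cost (RStore a i e) = 1 + ncost i + rcost e"
| "max_cost (Seq c d) = max_cost c + max_cost d"
| "max_cost (Cond b c d) = 1 + bcost b + max_cost c + max_cost d"
| "max_cost _ = 1"

lemma exec_straight_line:
  "straight_line c \<Longrightarrow> \<exists>t\<le>max_cost c. exec c s t (run c s)"
proof (induction c arbitrary: s)
  case Skip
  then show ?case using exec.Skip by auto
next
  case (NAssign x e)
  then show ?case using exec.NAssign by auto
next
  case (NStore a i e)
  then show ?case using exec.NStore by auto
next
  case (RAssign x e)
  then show ?case using exec.RAssign by auto
next
  case (RStore a i e)
  then show ?case using exec.RStore by auto
next
  case (Seq c d)
  obtain t where t: "t \<le> max_cost c" "exec c s t (run c s)" using Seq by fastforce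
  obtain u where u: "u \<le> max_cost d" "exec d (run c s) u (run d (run c s))"
    using Seq by fastforce
  show ?case using exec.Seq[OF t(2) u(2)] t(1) u(1) by (auto intro!: exI[of _ "t + u"])
next
  case (Cond b c d)
  show ?case
  proof (cases "bval b s")
    case True
    obtain t where t: "t \<le> max_cost c" "exec c s t (run c s)" using Cond by fastforce
    show ?thesis using exec.CondTrue[OF True t(2)] t(1) True
      by (auto intro!: exI[of _ "1 + bcost b + t"])
  next
    case False
    obtain t where t: "t \<le> max_cost d" "exec d s t (run d s)" using Cond by fastforce
    show ?thesis using exec.CondFalse[OF False t(2)] t(1) False
      by (auto intro!: exI[of _ "1 + bcost b + t"])
  qed
next
  case (While b c)
  then show ?case by simp
qed

lemma halts_straight_line: "straight_line c \<Longrightarrow> Q (run c s) \<Longrightarrow> halts c s (max_cost c) Q"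
  unfolding halts_def using exec_straight_line by blast

section \<open>Counting loops\<close>

definition For :: "string \<Rightarrow> string \<Rightarrow> com \<Rightarrow> com" where
  "For x y c = Seq (NAssign x (NConst 0))
     (While (NLess (NVar x) (NVar y)) (Seq c (NAssign x (NPlus (NVar x) (NConst 1)))))"

text \<open>Per round, 8 is the test (4) plus the increment (4); 6 is the initialization (2) plus
  the failing test (4). As the increment follows the body, the next invariant is demanded of the
  state with the counter already advanced.\<close>

lemma halts_For:
  assumes "x \<noteq> y" "nvar s y = N" "I 0 (s\<lparr>nvar := (nvar s)(x := 0)\<rparr>)"
    and body: "\<And>i s. i < N \<Longrightarrow> nvar s x = i \<Longrightarrow> nvar s y = N \<Longrightarrow> I i s \<Longrightarrow>
      halts c s B (\<lambda>s'. nvar s' x = i \<and> nvar s' y = N \<and>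
        I (Suc i) (s'\<lparr>nvar := (nvar s')(x := Suc i)\<rparr>))"
  shows "halts (For x y c) s (N * (B + 8) + 6) (\<lambda>s'. nvar s' y = N \<and> I N s')"
proof -
  let ?J = "\<lambda>i s. nvar s x = i \<and> nvar s y = N \<and> I i s"
  let ?b = "NLess (NVar x) (NVar y)" and ?inc = "NAssign x (NPlus (NVar x) (NConst 1))"
  have "halts (While ?b (Seq c ?inc)) s'
      ((N - 0) * (1 + bcost ?b + (B + max_cost ?inc)) + (1 + bcost ?b)) (?J N)"
    if "?J 0 s'" for s'
  proof (rule halts_While[of ?J, OF that])
    fix i s assume i: "i < N" and J: "?J i s"
    have "halts (Seq c ?inc) s (B + max_cost ?inc) (?J (Suc i))"
      by (rule halts_Seq[OF body[OF i] halts_straight_line]) (use J \<open>x \<noteq> y\<close> in auto)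
    then show "bval ?b s \<and> halts (Seq c ?inc) s (B + max_cost ?inc) (?J (Suc i))"
      using i J by simp
  qed auto
  then have "halts (For x y c) s (max_cost (NAssign x (NConst 0)) +
      ((N - 0) * (1 + bcost ?b + (B + max_cost ?inc)) + (1 + bcost ?b))) (?J N)"
    unfolding For_def using assms(1-3)
    by (intro halts_Seq[where Q = "?J 0"] halts_straight_line) auto
  then show ?thesis by (rule halts_mono) (auto simp: algebra_simps)
qed

section \<open>The program\<close>

text \<open>Flagging removed rather than remaining vertices makes the zeroed initial memory
  represent the full vertex set. The comparison with 1 is a test for zero.\<close>

definition alive :: "nexp \<Rightarrow> bexp" where
  "alive e = NLess (NArr ''dead'' e) (NConst 1)"

definition add_weight :: "nexp \<Rightarrow> com" where
  "add_weight e = RStore ''deg'' e (RPlus (RArr ''deg'' e) (RArr ''w'' (NVar ''j'')))"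

definition reset_degrees :: com where
  "reset_degrees = For ''j'' ''n'' (RStore ''deg'' (NVar ''j'') (RConst 0))"

definition compute_degrees :: com where
  "compute_degrees = For ''j'' ''m''
     (Cond (BAnd (alive (NArr ''src'' (NVar ''j''))) (alive (NArr ''dst'' (NVar ''j''))))
       (Seq (add_weight (NArr ''src'' (NVar ''j''))) (add_weight (NArr ''dst'' (NVar ''j''))))
       Skip)"

text \<open>Degrees are nonnegative, so the first remaining vertex always beats the start value
  -1.\<close>

definition find_max :: com where
  "find_max = Seq (RAssign ''best'' (RConst (-1)))
     (For ''j'' ''n''
       (Cond (BAnd (alive (NVar ''j'')) (RLess (RVar ''best'') (RArr ''deg'' (NVar ''j''))))
         (Seq (NAssign ''v'' (NVar ''j'')) (RAssign ''best'' (RArr ''deg'' (NVar ''j''))))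
         Skip))"

text \<open>Addresses below \<open>n\<close> are leaves, so the removed vertex is itself the left
  child of inner node \<open>n + i\<close>; the right child is the node that the next round will
  write.\<close>

definition record_node :: com where
  "record_node = Seq (NStore ''dead'' (NVar ''v'') (NConst 1))
     (Seq (NStore ''left'' (NPlus (NVar ''n'') (NVar ''i'')) (NVar ''v''))
       (NStore ''right'' (NPlus (NVar ''n'') (NVar ''i''))
         (NPlus (NPlus (NVar ''n'') (NVar ''i'')) (NConst 1))))"

definition peel :: com where
  "peel = For ''i'' ''n''
     (Seq reset_degrees (Seq compute_degrees (Seq find_max record_node)))"

text \<open>Peeling the last vertex writes a spurious inner node \<open>2 n - 1\<close>; the pointer to it from
  \<open>2 n - 2\<close> is redirected to that vertex.\<close>

definition set_root :: com where
  "set_root = Seq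
     (NStore ''right'' (NMinus (NPlus (NVar ''n'') (NVar ''n'')) (NConst 2)) (NVar ''v''))
     (Cond (NLess (NConst 1) (NVar ''n'')) (NAssign ''root'' (NVar ''n''))
       (NAssign ''root'' (NVar ''v'')))"

section \<open>Specifications of the three inner loops\<close>

lemma halts_reset_degrees:
  assumes "nvar s ''n'' = n"
  shows "halts reset_degrees s (n * 11 + 6)
    (\<lambda>s'. narr s' = narr s \<and> (\<forall>x. x \<noteq> ''j'' \<longrightarrow> nvar s' x = nvar s x) \<and>
      (\<forall>a. a \<noteq> ''deg'' \<longrightarrow> rarr s' a = rarr s a) \<and> (\<forall>u<n. rarr s' ''deg'' u = 0))"
proof -
  let ?I = "\<lambda>k s'. narr s' = narr s \<and> (\<forall>x. x \<noteq> ''j'' \<longrightarrow> nvar s' x = nvar s x) \<and>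
    (\<forall>a. a \<noteq> ''deg'' \<longrightarrow> rarr s' a = rarr s a) \<and> (\<forall>u<k. rarr s' ''deg'' u = 0)"
  have "halts reset_degrees s (n * (max_cost (RStore ''deg'' (NVar ''j'') (RConst 0)) + 8) + 6)
      (\<lambda>s'. nvar s' ''n'' = n \<and> ?I n s')"
    unfolding reset_degrees_def using assms
    by (intro halts_For[where I = ?I] halts_straight_line) (auto simp: less_Suc_eq)
  then show ?thesis by (rule halts_mono) auto
qed

text \<open>Distinct endpoints matter: the program would add the weight of a loop twice, while the
  sum counts it once.\<close>

lemma halts_compute_degrees:
  assumes "nvar s ''m'' = m" "\<And>k. k < m \<Longrightarrow> narr s ''src'' k \<noteq> narr s ''dst'' k"
    and "\<And>u. u < n \<Longrightarrow> rarr s ''deg'' u = 0"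
  shows "halts compute_degrees s (m * 40 + 6)
    (\<lambda>s'. narr s' = narr s \<and> (\<forall>x. x \<noteq> ''j'' \<longrightarrow> nvar s' x = nvar s x) \<and>
      (\<forall>a. a \<noteq> ''deg'' \<longrightarrow> rarr s' a = rarr s a) \<and>
      (\<forall>u<n. rarr s' ''deg'' u = (\<Sum>k<m.
        if {narr s ''src'' k, narr s ''dst'' k} \<subseteq> {v. narr s ''dead'' v = 0} \<and>
           u \<in> {narr s ''src'' k, narr s ''dst'' k} then rarr s ''w'' k else 0)))"
proof -
  let ?I = "\<lambda>q s'. narr s' = narr s \<and> (\<forall>x. x \<noteq> ''j'' \<longrightarrow> nvar s' x = nvar s x) \<and>
      (\<forall>a. a \<noteq> ''deg'' \<longrightarrow> rarr s' a = rarr s a) \<and>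
      (\<forall>u<n. rarr s' ''deg'' u = (\<Sum>k<q.
        if {narr s ''src'' k, narr s ''dst'' k} \<subseteq> {v. narr s ''dead'' v = 0} \<and>
           u \<in> {narr s ''src'' k, narr s ''dst'' k} then rarr s ''w'' k else 0))"
  let ?c = "Cond (BAnd (alive (NArr ''src'' (NVar ''j''))) (alive (NArr ''dst'' (NVar ''j''))))
       (Seq (add_weight (NArr ''src'' (NVar ''j''))) (add_weight (NArr ''dst'' (NVar ''j''))))
       Skip"
  have "halts compute_degrees s (m * (max_cost ?c + 8) + 6)
      (\<lambda>s'. nvar s' ''m'' = m \<and> ?I m s')"
    unfolding compute_degrees_def using assms assms(2)[symmetric]
    by (intro halts_For[where I = ?I] halts_straight_line) (auto simp: alive_def add_weight_def)
  then show ?thesis by (rule halts_mono) (auto simp: alive_def add_weight_def)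
qed

lemma halts_find_max:
  assumes "nvar s ''n'' = n" "\<exists>u<n. narr s ''dead'' u = 0"
    and nonneg: "\<And>u. u < n \<Longrightarrow> 0 \<le> rarr s ''deg'' u"
  shows "halts find_max s (n * 25 + 8)
    (\<lambda>s'. narr s' = narr s \<and> (\<forall>x. x \<noteq> ''j'' \<and> x \<noteq> ''v'' \<longrightarrow> nvar s' x = nvar s x) \<and>
      rarr s' = rarr s \<and> nvar s' ''v'' < n \<and> narr s ''dead'' (nvar s' ''v'') = 0 \<and>
      (\<forall>u<n. narr s ''dead'' u = 0 \<longrightarrow> rarr s ''deg'' u \<le> rarr s ''deg'' (nvar s' ''v'')))"
proof -
  \<comment> \<open>Until the first remaining vertex is met, \<open>best\<close> is still -1 and
    \<open>v\<close> carries no information; hence the disjunction.\<close>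
  define I where "I k s' \<longleftrightarrow> narr s' = narr s \<and>
      (\<forall>x. x \<noteq> ''j'' \<and> x \<noteq> ''v'' \<longrightarrow> nvar s' x = nvar s x) \<and> rarr s' = rarr s \<and>
      (\<forall>u<k. narr s ''dead'' u = 0 \<longrightarrow> rarr s ''deg'' u \<le> rvar s' ''best'') \<and>
      (rvar s' ''best'' = -1 \<or> nvar s' ''v'' < n \<and> narr s ''dead'' (nvar s' ''v'') = 0 \<and>
        rvar s' ''best'' = rarr s ''deg'' (nvar s' ''v''))" for k and s' :: state
  let ?init = "RAssign ''best'' (RConst (-1))"
  let ?c = "Cond (BAnd (alive (NVar ''j'')) (RLess (RVar ''best'') (RArr ''deg'' (NVar ''j''))))
         (Seq (NAssign ''v'' (NVar ''j'')) (RAssign ''best'' (RArr ''deg'' (NVar ''j''))))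
         Skip"
  have body: "halts ?c s1 (max_cost ?c) (\<lambda>s'. nvar s' ''j'' = k \<and> nvar s' ''n'' = n \<and>
      I (Suc k) (s'\<lparr>nvar := (nvar s')(''j'' := Suc k)\<rparr>))"
    if k: "k < n" "nvar s1 ''j'' = k" "nvar s1 ''n'' = n" and "I k s1" for k s1
  proof (rule halts_straight_line)
    show "straight_line ?c" by simp
    show "nvar (run ?c s1) ''j'' = k \<and> nvar (run ?c s1) ''n'' = n \<and>
        I (Suc k) ((run ?c s1)\<lparr>nvar := (nvar (run ?c s1))(''j'' := Suc k)\<rparr>)"
    proof (cases "narr s ''dead'' k = 0 \<and> rvar s1 ''best'' < rarr s ''deg'' k")
      case True
      have "rarr s ''deg'' u \<le> rarr s ''deg'' k" if "u < Suc k" "narr s ''dead'' u = 0" for u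
      proof (cases "u = k")
        case False
        then have "rarr s ''deg'' u \<le> rvar s1 ''best''" using \<open>I k s1\<close> that by (simp add: I_def)
        then show ?thesis using True by linarith
      qed simp
      then show ?thesis using \<open>I k s1\<close> k True by (simp add: alive_def I_def)
    next
      case False
      have "rarr s ''deg'' u \<le> rvar s1 ''best''" if "u < Suc k" "narr s ''dead'' u = 0" for u
        using \<open>I k s1\<close> False that by (cases "u = k") (simp_all add: I_def)
      moreover have "narr s1 = narr s" "rarr s1 = rarr s" using \<open>I k s1\<close> by (simp_all add: I_def)
      then have "\<not> bval (BAnd (alive (NVar ''j'')) (RLess (RVar ''best'') (RArr ''deg'' (NVar ''j'')))) s1"
        using k(2) False by (simp add: alive_def)
      then have "run ?c s1 = s1" by (simp only: run.simps if_False)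
      ultimately show ?thesis using \<open>I k s1\<close> k by (simp add: I_def)
    qed
  qed
  have loop: "halts (For ''j'' ''n'' ?c) s' (n * (max_cost ?c + 8) + 6)
      (\<lambda>s'. nvar s' ''n'' = n \<and> I n s')" if "s' = run ?init s" for s'
  proof (rule halts_For[where I = I])
    show "I 0 (s'\<lparr>nvar := (nvar s')(''j'' := 0)\<rparr>)" by (simp add: I_def that of_rat_minus)
    show "nvar s' ''n'' = n" using that assms(1) by simp
  qed (simp, rule body)
  have "halts find_max s (max_cost ?init + (n * (max_cost ?c + 8) + 6))
      (\<lambda>s'. nvar s' ''n'' = n \<and> I n s')"
    unfolding find_max_def
    by (rule halts_Seq[OF halts_straight_line[where Q = "\<lambda>s'. s' = run ?init s"] loop]) auto
  then show ?thesis
  proof (rule halts_mono)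
    fix s' assume s': "nvar s' ''n'' = n \<and> I n s'"
    obtain u where u: "u < n" "narr s ''dead'' u = 0" using assms(2) by blast
    \<comment> \<open>\<open>best\<close> dominates the nonnegative degree of the remaining vertex
      \<open>u\<close>, so -1 has been replaced and \<open>v\<close> is meaningful.\<close>
    have ne: "rvar s' ''best'' \<noteq> -1" using s' u nonneg[OF u(1)] unfolding I_def by force
    then have best: "rvar s' ''best'' = rarr s ''deg'' (nvar s' ''v'')"
      using s' unfolding I_def by blast
    show "narr s' = narr s \<and> (\<forall>x. x \<noteq> ''j'' \<and> x \<noteq> ''v'' \<longrightarrow> nvar s' x = nvar s x) \<and>
      rarr s' = rarr s \<and> nvar s' ''v'' < n \<and> narr s ''dead'' (nvar s' ''v'') = 0 \<and>
      (\<forall>u<n. narr s ''dead'' u = 0 \<longrightarrow> rarr s ''deg'' u \<le> rarr s ''deg'' (nvar s' ''v''))"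
      using s' ne unfolding I_def best by blast
  qed (simp add: alive_def)
qed

section \<open>Correctness of the program\<close>

text \<open>The part of \<open>input_state\<close> that persists during the run; the scratch memory
  is left free.\<close>

definition holds_input :: "nat \<Rightarrow> (nat \<times> nat) list \<Rightarrow> (nat set \<Rightarrow> real) \<Rightarrow> state \<Rightarrow> bool" where
  "holds_input n es w s \<longleftrightarrow> nvar s ''n'' = n \<and> nvar s ''m'' = length es \<and>
     (\<forall>k<length es. narr s ''src'' k = fst (es ! k) \<and> narr s ''dst'' k = snd (es ! k) \<and>
       rarr s ''w'' k = w {fst (es ! k), snd (es ! k)})"

text \<open>Distinctness of the listing makes the map from positions to edges a bijection.\<close>

lemma sum_edge_listing:
  assumes "edge_listing E es"
  shows "(\<Sum>k<length es. f {fst (es ! k), snd (es ! k)}) = sum f E"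
proof -
  let ?g = "\<lambda>(i, j). {i, j}"
  have "bij_betw (\<lambda>k. map ?g es ! k) {..<length (map ?g es)} E"
    using assms unfolding edge_listing_def by (intro bij_betw_nth) auto
  from sum.reindex_bij_betw[OF this, of f] show ?thesis
    by (simp add: case_prod_beta)
qed

lemma edge_listing_neq:
  assumes "weighted_graph V E w" "edge_listing E es" "k < length es"
  shows "fst (es ! k) \<noteq> snd (es ! k)"
proof
  assume eq: "fst (es ! k) = snd (es ! k)"
  have "(\<lambda>(i, j). {i, j}) (es ! k) \<in> E"
    using assms(2) nth_mem[OF assms(3)] unfolding edge_listing_def set_map by blast
  then show False using eq assms(1) by (auto simp: weighted_graph_def case_prod_beta)
qed

text \<open>\<open>vs\<close> lists the vertices removed so far. The others have no order yet, so
  the greedy condition is phrased with complements in \<open>{..<n}\<close>. The last right pointer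
  aims at a node not yet written, and \<open>v\<close> is kept so that this pointer can be repaired
  at the end.\<close>

definition peel_inv ::
  "nat \<Rightarrow> nat set set \<Rightarrow> (nat set \<Rightarrow> real) \<Rightarrow> (nat \<times> nat) list \<Rightarrow> nat list \<Rightarrow> state \<Rightarrow> bool" where
  "peel_inv n E w es vs s \<longleftrightarrow> holds_input n es w s \<and> distinct vs \<and> set vs \<subseteq> {..<n} \<and>
     (\<forall>u. narr s ''dead'' u = (if u \<in> set vs then 1 else 0)) \<and>
     (\<forall>p<length vs. narr s ''left'' (n + p) = vs ! p \<and> narr s ''right'' (n + p) = n + p + 1) \<and>
     (vs \<noteq> [] \<longrightarrow> nvar s ''v'' = last vs) \<and>
     (\<forall>p<length vs. \<forall>u\<in>{..<n} - set (take p vs).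
        wdegree E w ({..<n} - set (take p vs)) u \<le>
        wdegree E w ({..<n} - set (take p vs)) (vs ! p))"

text \<open>36 = 11 + 25 collects the two loops over vertices; the last 40 covers 6 + 6 + 8 and the
  cost 17 of \<open>record_node\<close>.\<close>

lemma halts_peel_step:
  assumes G: "weighted_graph {..<n} E w" and es: "edge_listing E es"
    and I: "peel_inv n E w es vs s" and i: "nvar s ''i'' = length vs" and less: "length vs < n"
  shows "halts (Seq reset_degrees (Seq compute_degrees (Seq find_max record_node))) s
    (36 * n + 40 * length es + 40)
    (\<lambda>s'. nvar s' ''i'' = length vs \<and> (\<exists>v. peel_inv n E w es (vs @ [v]) s'))"
proof -
  let ?S = "{..<n} - set vs"
  have inp: "holds_input n es w s" and dead: "narr s ''dead'' u = (if u \<in> set vs then 1 else 0)" for u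
    using I by (auto simp: peel_inv_def)
  have fin: "finite E" using finite_edges[OF G] .
  \<comment> \<open>What the three loops leave intact: everything relevant except
    \<open>deg\<close>, \<open>best\<close>, \<open>j\<close> and \<open>v\<close>.\<close>
  define frame where "frame s' \<longleftrightarrow> narr s' = narr s \<and>
    (\<forall>x. x \<noteq> ''j'' \<and> x \<noteq> ''v'' \<longrightarrow> nvar s' x = nvar s x) \<and> rarr s' ''w'' = rarr s ''w''" for s' :: state
  have "\<exists>u<n. u \<notin> set vs"
  proof (rule ccontr)
    assume "\<not> ?thesis"
    then have "{..<n} \<subseteq> set vs" by auto
    then have "n \<le> card (set vs)" using card_mono[of "set vs" "{..<n}"] by simp
    then show False using less card_length[of vs] by linarith
  qed
  then have ex: "\<exists>u<n. narr s ''dead'' u = 0" using dead by auto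
  have deg: "(\<Sum>k<length es.
        if {narr s' ''src'' k, narr s' ''dst'' k} \<subseteq> {v. narr s' ''dead'' v = 0} \<and>
           u \<in> {narr s' ''src'' k, narr s' ''dst'' k} then rarr s' ''w'' k else 0) =
      wdegree E w ?S u" (is "?sum = _") if "frame s'" for s' u
  proof -
    let ?f = "\<lambda>e. if e \<subseteq> - set vs \<and> u \<in> e then w e else 0"
    have alive: "{v. narr s' ''dead'' v = 0} = - set vs"
      using dead that by (auto simp: frame_def)
    have "?sum = (\<Sum>k<length es. ?f {fst (es ! k), snd (es ! k)})"
      using inp that unfolding holds_input_def frame_def alive by (intro sum.cong) auto
    also have "\<dots> = sum ?f E" by (rule sum_edge_listing[OF es])
    also have "\<dots> = sum w {e \<in> E. e \<subseteq> - set vs \<and> u \<in> e}"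
      using fin by (simp add: sum.inter_filter[symmetric])
    \<comment> \<open>The flags describe all addresses outside \<open>vs\<close>, an infinite set;
      edges lie below \<open>n\<close>, so restricting to \<open>?S\<close> changes nothing.\<close>
    also have "{e \<in> E. e \<subseteq> - set vs \<and> u \<in> e} = {e \<in> E. e \<subseteq> ?S \<and> u \<in> e}"
      using G unfolding weighted_graph_def by blast
    finally show ?thesis unfolding wdegree_def .
  qed
  have 1: "halts reset_degrees s (n * 11 + 6)
      (\<lambda>s'. frame s' \<and> (\<forall>u<n. rarr s' ''deg'' u = 0))"
    by (rule halts_mono[OF halts_reset_degrees])
      (use inp in \<open>auto simp: frame_def holds_input_def\<close>)
  have 2: "halts compute_degrees s1 (length es * 40 + 6)
      (\<lambda>s'. frame s' \<and> (\<forall>u<n. rarr s' ''deg'' u = wdegree E w ?S u))"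
    if s1: "frame s1 \<and> (\<forall>u<n. rarr s1 ''deg'' u = 0)" for s1
  proof (rule halts_mono[OF halts_compute_degrees[where n = n]])
    show "nvar s1 ''m'' = length es"
      using s1 inp by (simp add: frame_def holds_input_def)
    show "narr s1 ''src'' k \<noteq> narr s1 ''dst'' k" if "k < length es" for k
      using s1 inp edge_listing_neq[OF G es that] that by (simp add: frame_def holds_input_def)
    show "rarr s1 ''deg'' u = 0" if "u < n" for u using s1 that by simp
  qed (use s1 deg[of s1] in \<open>auto simp: frame_def\<close>)
  have 3: "halts find_max s2 (n * 25 + 8)
      (\<lambda>s'. frame s' \<and> nvar s' ''v'' \<in> ?S \<and>
        (\<forall>u\<in>?S. wdegree E w ?S u \<le> wdegree E w ?S (nvar s' ''v'')))"
    if s2: "frame s2 \<and> (\<forall>u<n. rarr s2 ''deg'' u = wdegree E w ?S u)" for s2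
  proof (rule halts_mono[OF halts_find_max[where n = n]])
    show "nvar s2 ''n'' = n" using s2 inp by (simp add: frame_def holds_input_def)
    show "\<exists>u<n. narr s2 ''dead'' u = 0" using s2 ex by (simp add: frame_def)
    show "0 \<le> rarr s2 ''deg'' u" if "u < n" for u
      using s2 that wdegree_nonneg[OF G] by simp
  next
    fix s' :: state
    assume s': "narr s' = narr s2 \<and> (\<forall>x. x \<noteq> ''j'' \<and> x \<noteq> ''v'' \<longrightarrow> nvar s' x = nvar s2 x) \<and>
      rarr s' = rarr s2 \<and> nvar s' ''v'' < n \<and> narr s2 ''dead'' (nvar s' ''v'') = 0 \<and>
      (\<forall>u<n. narr s2 ''dead'' u = 0 \<longrightarrow> rarr s2 ''deg'' u \<le> rarr s2 ''deg'' (nvar s' ''v''))"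
    have alive: "narr s2 ''dead'' u = 0 \<longleftrightarrow> u \<notin> set vs" for u
      using s2 dead by (simp add: frame_def)
    have "frame s'" using s' s2 unfolding frame_def by simp
    moreover have "nvar s' ''v'' \<in> ?S" using s' alive by simp
    moreover have "wdegree E w ?S u \<le> wdegree E w ?S (nvar s' ''v'')" if "u \<in> ?S" for u
    proof -
      have deg: "rarr s2 ''deg'' x = wdegree E w ?S x" if "x < n" for x using s2 that by blast
      have "rarr s2 ''deg'' u \<le> rarr s2 ''deg'' (nvar s' ''v'')"
        using s' alive[of u] that by blast
      then show ?thesis using deg[of u] deg[of "nvar s' ''v''"] s' that by simp
    qed
    ultimately show "frame s' \<and> nvar s' ''v'' \<in> ?S \<and>
        (\<forall>u\<in>?S. wdegree E w ?S u \<le> wdegree E w ?S (nvar s' ''v''))" by blast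
  qed simp
  have 4: "halts record_node s3 (max_cost record_node)
      (\<lambda>s'. nvar s' ''i'' = length vs \<and> (\<exists>v. peel_inv n E w es (vs @ [v]) s'))"
    if s3: "frame s3 \<and> nvar s3 ''v'' \<in> ?S \<and>
        (\<forall>u\<in>?S. wdegree E w ?S u \<le> wdegree E w ?S (nvar s3 ''v''))" for s3
  proof (rule halts_straight_line)
    show "straight_line record_node" by (simp add: record_node_def)
    have "peel_inv n E w es (vs @ [nvar s3 ''v'']) (run record_node s3)"
      using s3 I i unfolding peel_inv_def holds_input_def frame_def record_node_def
      by (auto simp: nth_append less_Suc_eq)
    moreover have "nvar (run record_node s3) ''i'' = length vs"
      using s3 i by (simp add: record_node_def frame_def)
    ultimately show "nvar (run record_node s3) ''i'' = length vs \<and>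
        (\<exists>v. peel_inv n E w es (vs @ [v]) (run record_node s3))" by blast
  qed
  have "halts (Seq reset_degrees (Seq compute_degrees (Seq find_max record_node))) s
      ((n * 11 + 6) + ((length es * 40 + 6) + ((n * 25 + 8) + max_cost record_node)))
      (\<lambda>s'. nvar s' ''i'' = length vs \<and> (\<exists>v. peel_inv n E w es (vs @ [v]) s'))"
    using 4 by (intro halts_Seq[OF 1] halts_Seq[OF 2] halts_Seq[OF 3])
  then show ?thesis by (rule halts_mono) (auto simp: record_node_def)
qed

lemma halts_peel:
  assumes G: "weighted_graph {..<n} E w" and es: "edge_listing E es"
  shows "halts peel (input_state n es w) (n * (36 * n + 40 * length es + 48) + 6)
    (\<lambda>s. \<exists>vs. length vs = n \<and> peel_inv n E w es vs s)"
proof -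
  let ?I = "\<lambda>i s. \<exists>vs. length vs = i \<and> peel_inv n E w es vs s"
  \<comment> \<open>The invariant does not mention the counter, so advancing \<open>i\<close>
    preserves it.\<close>
  have frame: "peel_inv n E w es vs (s\<lparr>nvar := (nvar s)(''i'' := k)\<rparr>) = peel_inv n E w es vs s"
    for vs s k by (simp add: peel_inv_def holds_input_def)
  have "halts peel (input_state n es w) (n * ((36 * n + 40 * length es + 40) + 8) + 6)
      (\<lambda>s. nvar s ''n'' = n \<and> ?I n s)"
    unfolding peel_def
  proof (rule halts_For[where I = ?I])
    show "?I 0 ((input_state n es w)\<lparr>nvar := (nvar (input_state n es w))(''i'' := 0)\<rparr>)"
      by (simp add: frame) (simp add: peel_inv_def holds_input_def input_state_def)
  next
    fix i s assume "i < n" "nvar s ''i'' = i" "nvar s ''n'' = n" "?I i s"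
    then obtain vs where vs: "length vs = i" "peel_inv n E w es vs s" by blast
    show "halts (Seq reset_degrees (Seq compute_degrees (Seq find_max record_node))) s
      (36 * n + 40 * length es + 40) (\<lambda>s'. nvar s' ''i'' = i \<and> nvar s' ''n'' = n \<and>
        ?I (Suc i) (s'\<lparr>nvar := (nvar s')(''i'' := Suc i)\<rparr>))"
    proof (rule halts_mono[OF halts_peel_step[OF G es vs(2)]])
      fix s' assume s': "nvar s' ''i'' = length vs \<and> (\<exists>v. peel_inv n E w es (vs @ [v]) s')"
      then obtain v where v: "peel_inv n E w es (vs @ [v]) s'" by blast
      then have "nvar s' ''n'' = n" by (simp add: peel_inv_def holds_input_def)
      moreover have "length (vs @ [v]) = Suc i" using vs(1) by simp
      ultimately show "nvar s' ''i'' = i \<and> nvar s' ''n'' = n \<and>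
          ?I (Suc i) (s'\<lparr>nvar := (nvar s')(''i'' := Suc i)\<rparr>)"
        unfolding frame using v s' vs(1) by blast
    qed (use vs \<open>i < n\<close> \<open>nvar s ''i'' = i\<close> in auto)
  qed (auto simp: input_state_def)
  then show ?thesis by (rule halts_mono) auto
qed

text \<open>A caterpillar on \<open>n\<close> >= 2 leaves has \<open>n - 1\<close> inner nodes, at
  addresses n, ..., 2 n - 2. The induction climbs from the lowest one, whose children are both
  leaves, towards the root.\<close>

lemma tree_at_caterpillar:
  assumes "length vs = n" "set vs \<subseteq> {..<n}"
    and left: "\<And>p. p < n - 1 \<Longrightarrow> narr s ''left'' (n + p) = vs ! p"
    and right: "\<And>p. p < n - 2 \<Longrightarrow> narr s ''right'' (n + p) = n + p + 1"
    and last: "2 \<le> n \<Longrightarrow> narr s ''right'' (n + (n - 2)) = vs ! (n - 1)"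
    and "p \<le> n - 2" "2 \<le> n"
  shows "tree_at n s (n + p) (caterpillar (drop p vs))"
  using assms(6)
proof (induction rule: inc_induct)
  case base
  have "drop (n - 2) vs = [vs ! (n - 2), vs ! (n - 1)]"
    using assms(1,7) Cons_nth_drop_Suc[of "n - 2" vs] Cons_nth_drop_Suc[of "n - 1" vs]
    by (simp add: Suc_diff_Suc numeral_2_eq_2)
  moreover have "vs ! (n - 2) < n" "vs ! (n - 1) < n"
    using assms(1,2,7) by (simp_all add: subset_iff)
  ultimately show ?case
    using left[of "n - 2"] last assms(7) by (auto intro!: tree_at.intros)
next
  case (step p)
  have d: "drop p vs = vs ! p # drop (Suc p) vs"
    using assms(1) step.hyps by (simp add: Cons_nth_drop_Suc)
  have ne: "drop (Suc p) vs \<noteq> []" using assms(1) step.hyps by simp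
  have "vs ! p < n" using assms(1,2) step.hyps by (simp add: subset_iff)
  then show ?case
    unfolding d caterpillar_Cons[OF ne]
    using left[of p] right[of p] step by (auto intro!: tree_at.intros)
qed

lemma run_set_root:
  assumes I: "peel_inv n E w es vs s" and len: "length vs = n" and "0 < n"
  shows "output_tree n (run set_root s) (caterpillar vs)"
proof -
  have n: "nvar s ''n'' = n" and vs: "set vs \<subseteq> {..<n}" and v: "nvar s ''v'' = vs ! (n - 1)"
    using I len \<open>0 < n\<close> by (auto simp: peel_inv_def holds_input_def last_conv_nth)
  show ?thesis
  proof (cases "n = 1")
    \<comment> \<open>There is no inner node: the root is the leaf itself. The store goes to
      position 0 of \<open>right\<close>, which is never read because address 0 is a leaf.\<close>
    case True
    then obtain u where "vs = [u]" using len by (auto simp: length_Suc_conv)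
    then show ?thesis using True n v vs
      by (auto simp: output_tree_def set_root_def intro!: tree_at.intros)
  next
    case False
    then have n2: "2 \<le> n" using \<open>0 < n\<close> by simp
    have "tree_at n (run set_root s) (n + 0) (caterpillar (drop 0 vs))"
      using I len n2 n v vs
      by (intro tree_at_caterpillar) (auto simp: set_root_def peel_inv_def)
    then show ?thesis using n n2 by (simp add: output_tree_def set_root_def)
  qed
qed

text \<open>\<open>n\<close> distinct numbers below \<open>n\<close> exhaust \<open>{..<n}\<close>,
  so the complement of a prefix of \<open>vs\<close> is the remaining suffix.\<close>

lemma peel_inv_peeling:
  assumes "peel_inv n E w es vs s" "length vs = n"
  shows "set vs = {..<n}" "peeling E w vs"
proof -
  have d: "distinct vs" and "set vs \<subseteq> {..<n}" using assms(1) by (auto simp: peel_inv_def)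
  then show V: "set vs = {..<n}"
    using assms(2) by (intro card_subset_eq) (auto simp: distinct_card)
  have "set (drop p vs) = {..<n} - set (take p vs)" for p
  proof -
    have "set (take p vs) \<inter> set (drop p vs) = {}"
      using d by (simp add: set_take_disj_set_drop_if_distinct)
    moreover have "set (take p vs) \<union> set (drop p vs) = {..<n}"
      unfolding V[symmetric] by (metis append_take_drop_id set_append)
    ultimately show ?thesis by blast
  qed
  then show "peeling E w vs" using assms(1) unfolding peeling_def peel_inv_def by simp
qed

section \<open>Running time and conclusion\<close>

lemma time_bound:
  fixes n m :: nat
  assumes "0 < n"
  shows "n * (36 * n + 40 * m + 48) + 30 \<le> 120 * (n\<^sup>2 * (n + m))"
proof -
  \<comment> \<open>30 covers the 6 from the outer loop and the cost 15 of \<open>set_root\<close>.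
    As \<open>n\<close> >= 1, lower-order terms are absorbed into the square: 114 = 36 + 48 + 30.
    The next step gives away a whole factor \<open>n\<close>.\<close>
  have "n * (36 * n + 40 * m + 48) + 30 \<le> n * (114 * (n + m))"
    using assms by (cases n) (auto simp: algebra_simps)
  also have "\<dots> \<le> n * (n * (120 * (n + m)))"
    using assms mult_le_mono[of 1 n "114 * (n + m)" "120 * (n + m)"]
    by (intro mult_le_mono2) simp
  finally show ?thesis by (simp add: power2_eq_square algebra_simps)
qed

theorem theorem4:
  shows "\<exists>(P :: com) (c :: nat).
    \<forall>(n :: nat) (E :: nat set set) (w :: nat set \<Rightarrow> real) (es :: (nat \<times> nat) list).
      weighted_graph {..<n} E w \<and> edge_listing E es \<longrightarrow>
      (\<exists>(t :: nat) (s :: state) (T :: nat htree).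
         exec P (input_state n es w) t s \<and>
         t \<le> c * (n\<^sup>2 * (n + card E)) \<and>
         output_tree n s T \<and>
         hierarchical_clustering {..<n} T \<and>
         hc_value E w T \<ge> 2 / 3 * Max (hc_value E w ` {T'. hierarchical_clustering {..<n} T'}))"
proof (rule exI[of _ "Seq peel set_root"], rule exI[of _ 120], intro allI impI, elim conjE)
  fix n :: nat and E :: "nat set set" and w :: "nat set \<Rightarrow> real" and es :: "(nat \<times> nat) list"
  assume G: "weighted_graph {..<n} E w" and es: "edge_listing E es"
  have n: "0 < n" using G by (auto simp: weighted_graph_def lessThan_empty_iff)
  have m: "length es = card E" using es unfolding edge_listing_def
    by (metis distinct_card length_map)
  let ?Q = "\<lambda>s. \<exists>T. output_tree n s T \<and> hierarchical_clustering {..<n} T \<and>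
    hc_value E w T \<ge> 2 / 3 * Max (hc_value E w ` {T'. hierarchical_clustering {..<n} T'})"
  have root: "halts set_root s (max_cost set_root) ?Q"
    if s: "\<exists>vs. length vs = n \<and> peel_inv n E w es vs s" for s
  proof -
    obtain vs where vs: "length vs = n" "peel_inv n E w es vs s" using s by blast
    have "distinct vs" using vs(2) by (simp add: peel_inv_def)
    moreover note V = peel_inv_peeling[OF vs(2,1)]
    ultimately have "hierarchical_clustering {..<n} (caterpillar vs)"
      using leaves_caterpillar[of vs] vs(1) n unfolding hierarchical_clustering_def by fastforce
    then have "?Q (run set_root s)"
      using run_set_root[OF vs(2,1) n] peeling_two_thirds[OF G \<open>distinct vs\<close> V] by blast
    then show ?thesis by (intro halts_straight_line) (simp_all add: set_root_def)
  qed
  have "halts (Seq peel set_root) (input_state n es w) (120 * (n\<^sup>2 * (n + card E))) ?Q"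
    by (rule halts_mono[OF halts_Seq[OF halts_peel[OF G es] root]])
      (use time_bound[OF n, of "card E"] in \<open>simp_all add: m set_root_def\<close>)
  then show "\<exists>t s T. exec (Seq peel set_root) (input_state n es w) t s \<and>
      t \<le> 120 * (n\<^sup>2 * (n + card E)) \<and> output_tree n s T \<and> hierarchical_clustering {..<n} T \<and>
      hc_value E w T \<ge> 2 / 3 * Max (hc_value E w ` {T'. hierarchical_clustering {..<n} T'})"
    unfolding halts_def by blast
qed

end
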